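(* Let $k\ge 1$ and assume $\operatorname{int}S_{k-1}\neq\emptyset$. Suppose $\mathbf{x}_{k-1}\in\partial S_{k-1}$. If $\mathbf{x}_k\in X(\mathbf{x}_{k-1},z_k)$, then $\mathbf{x}_k$ is a successor to $\mathbf{x}_{k-1}$ and $\mathbf{x}_k\in\partial S_k$.
   Context: Let $m\ge 1$ be an integer, and let $(d_1,\dots,d_{m+1})$, $(n_1,\dots,n_{m+1})$ be real vectors with $d_1=1$, $d_{m+1}\neq 0$, such that the polynomials $\sum_{i=1}^{m+1}n_i\lambda^{i-1}$ and $\sum_{i=1}^{m+1}d_i\lambda^{i-1}$ are coprime. Estimation system. $A$ is the $m\times m$ matrix with ones on the first superdiagonal, last row $(-d_{m+1},-d_m,\dots,-d_2)$ and zeros elsewhere; $B=(0,\dots,0,1)^T\in\mathbb{R}^m$; $C$ is the row vector $(n_{m+1},\dots,n_2)-n_1(d_{m+1},\dots,d_2)$; $D_1=n_1$. The dynamics are $\mathbf{x}_k=A\mathbf{x}_{k-1}+Bv_k$, $y_k=C\mathbf{x}_{k-1}+D_1v_k$, with given initial state $\mathbf{x}_0\in\mathbb{R}^m$ and given real measurements $z_1,z_2,\dots$. The uncertainty sets are the polytopes $S_0=\{\mathbf{x}_0\}$ and, for $k\ge1$, $$S_k=\{A\mathbf{x}+Bv:\ \mathbf{x}\in S_{k-1},\ |v|\le 1,\ |C\mathbf{x}+D_1v-z_k|\le 1\}.$$ $\mathbf{x}_k\in S_k$ is a successor to $\mathbf{x}_{k-1}\in S_{k-1}$ if there is a scalar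 $v$ with $|v|\le1$, $|C\mathbf{x}_{k-1}+D_1v-z_k|\le1$ and $\mathbf{x}_k=A\mathbf{x}_{k-1}+Bv$. Regulator matrices. $A^{\ast}$ is the $m\times m$ matrix with first column $-\frac{1}{d_{m+1}}(d_m,d_{m-1},\dots,d_1)^T$, ones on the first superdiagonal, zeros elsewhere (for $m=1$, $A^{\ast}=-1/d_2$); $B^{\ast}=(n_m,\dots,n_1)^T-\frac{n_{m+1}}{d_{m+1}}(d_m,\dots,d_1)^T$. For a polytope $S\subset\mathbb{R}^m$, $\partial S$ and $\operatorname{int}S$ are its boundary and interior, $h_S(\mathbf{x}^{\ast})=\max_{\mathbf{x}\in S}\langle\mathbf{x}^{\ast},\mathbf{x}\rangle$, and for $\mathbf{x}\in\partial S$, $C_S^{O}(\mathbf{x})=\{\mathbf{x}^{\ast}\neq\mathbf{0}:\langle\mathbf{x}^{\ast},\mathbf{x}\rangle=h_S(\mathbf{x}^{\ast})\}$. $(\mathbf{x}^{\ast})_1$ is the first component of $\mathbf{x}^{\ast}$. The scalar pair $(y,v)$ is aligned at time $k$ with $(y^{\ast},v^{\ast})$ if: $v^{\ast}>0\Rightarrow v=1$; $v^{\ast}<0\Rightarrow v=-1$; $|v|<1\Rightarrow v^{\ast}=0$; $y^{\ast}>0\Rightarrow y=1+z_k$; $y^{\ast}<0\Rightarrow y=-1+z_k$; $|y-z_k|<1\Rightarrow y^{\ast}=0$. For scalars $s,t,z_k$, $M(s,t,z_k)$ is the set of quadruples $\mathbf{q}=(q_1,q_2,q_3,q_4)=(v,y,v^{\ast},y^{\ast})\in\mathbb{R}^4$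 with: $|v|\le1$ and $|y-z_k|\le1$; $y-n_1v=s$; $d_{m+1}v^{\ast}+n_{m+1}y^{\ast}=-t$; and $(y,v)$ aligned at time $k$ with $(y^{\ast},v^{\ast})$. For $\mathbf{x}_{k-1}\in\partial S_{k-1}$ let $R_1,R_2,R_3$ be the subsets of $C_{S_{k-1}}^{O}(\mathbf{x}_{k-1})$ of vectors with first component respectively $=0$, $>0$, $<0$. Define $R(\mathbf{x}_{k-1})=R_1$ if $R_1\neq\emptyset$; $R(\mathbf{x}_{k-1})=R_2$ if $R_1=\emptyset$ and $R_2\neq\emptyset$; $R(\mathbf{x}_{k-1})=R_3$ if $R_1=\emptyset$ and $R_3\neq\emptyset$ (if $R_1=\emptyset$, exactly one of $R_2,R_3$ is non-empty). For $\mathbf{x}_{k-1}^{\ast}\in R(\mathbf{x}_{k-1})$, $$T(\mathbf{x}_{k-1},\mathbf{x}_{k-1}^{\ast},z_k)=\{(A\mathbf{x}_{k-1}+Bq_1,\ A^{\ast}\mathbf{x}_{k-1}^{\ast}+B^{\ast}q_4):\ \mathbf{q}\in M(C\mathbf{x}_{k-1},(\mathbf{x}_{k-1}^{\ast})_1,z_k),\ A^{\ast}\mathbf{x}_{k-1}^{\ast}+B^{\ast}q_4\neq\mathbf{0}\},$$ and $X(T)=\{\mathbf{x}_k:(\mathbf{x}_k,\mathbf{x}_k^{\ast})\in T\text{ for some }\mathbf{x}_k^{\ast}\}$. The set $X(\mathbf{x}_{k-1},z_k)$ is $X(T(\mathbf{x}_{k-1},\mathbf{x}_{k-1}^{\ast},z_k))$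 for an arbitrarily selected $\mathbf{x}_{k-1}^{\ast}\in R(\mathbf{x}_{k-1})$ (the paper treats it as not depending on this choice). *)

theory Defs
  imports "HOL-Analysis.Analysis" "HOL-Computational_Algebra.Polynomial"
begin

text \<open>
  Vectors of length \<open>m\<close> are elements of \<open>real ^ 'm\<close> with \<open>m = CARD('m)\<close>; the linear
  order on the index type \<open>'m\<close> provides the numbering \<open>1, \<dots>, m\<close> of the coordinates.
  The coefficient vectors \<open>d\<close> and \<open>n\<close> are functions of which only the values
  at \<open>1, \<dots>, m + 1\<close> are used.
\<close>

definition pos :: "'m::{finite,linorder} \<Rightarrow> nat" where
  "pos i = card {j. j \<le> i}"

definition first_comp :: "real ^ 'm::{finite,linorder} \<Rightarrow> real" where
  "first_comp x = x $ Min UNIV"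

definition coeff_poly :: "nat \<Rightarrow> (nat \<Rightarrow> real) \<Rightarrow> real poly" where
  "coeff_poly m c = (\<Sum>i=1..m+1. monom (c i) (i - 1))"


subsection \<open>Estimation system\<close>

definition matA :: "(nat \<Rightarrow> real) \<Rightarrow> real ^ 'm::{finite,linorder} ^ 'm::_" where
  "matA d = (\<chi> i j. if pos i = CARD('m) then - d (CARD('m) + 2 - pos j)
                     else if pos j = pos i + 1 then 1 else 0)"

definition vecB :: "real ^ 'm::{finite,linorder}" where
  "vecB = (\<chi> i. if pos i = CARD('m) then 1 else 0)"

text \<open>The row vector \<open>C\<close> acts on \<open>x\<close> by \<open>vecC d n \<bullet> x\<close>; the scalar \<open>D\<^sub>1\<close> is \<open>n 1\<close>.\<close>

definition vecC :: "(nat \<Rightarrow> real) \<Rightarrow> (nat \<Rightarrow> real) \<Rightarrow> real ^ 'm::{finite,linorder}" where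
  "vecC d n = (\<chi> j. n (CARD('m) + 2 - pos j) - n 1 * d (CARD('m) + 2 - pos j))"

fun uncertainty_set ::
  "(nat \<Rightarrow> real) \<Rightarrow> (nat \<Rightarrow> real) \<Rightarrow> real ^ 'm::{finite,linorder} \<Rightarrow> (nat \<Rightarrow> real)
     \<Rightarrow> nat \<Rightarrow> (real ^ 'm::_) set" where
  "uncertainty_set d n x0 z 0 = {x0}"
| "uncertainty_set d n x0 z (Suc k) =
     {matA d *v x + v *\<^sub>R vecB | x v.
        x \<in> uncertainty_set d n x0 z k \<and> \<bar>v\<bar> \<le> 1 \<and> \<bar>vecC d n \<bullet> x + n 1 * v - z (Suc k)\<bar> \<le> 1}"

text \<open>\<open>successor d n x0 z k x' x\<close>: \<open>x' \<in> S\<^sub>k\<close> is a successor to \<open>x \<in> S\<^bsub>k-1\<^esub>\<close>, for \<open>k \<ge> 1\<close>.\<close>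

definition successor ::
  "(nat \<Rightarrow> real) \<Rightarrow> (nat \<Rightarrow> real) \<Rightarrow> real ^ 'm::{finite,linorder} \<Rightarrow> (nat \<Rightarrow> real)
     \<Rightarrow> nat \<Rightarrow> real ^ 'm::_ \<Rightarrow> real ^ 'm::_ \<Rightarrow> bool" where
  "successor d n x0 z k x' x \<longleftrightarrow>
     x \<in> uncertainty_set d n x0 z (k - 1) \<and> x' \<in> uncertainty_set d n x0 z k \<and>
     (\<exists>v. \<bar>v\<bar> \<le> 1 \<and> \<bar>vecC d n \<bullet> x + n 1 * v - z k\<bar> \<le> 1 \<and> x' = matA d *v x + v *\<^sub>R vecB)"


subsection \<open>Regulator system\<close>

definition matA_star :: "(nat \<Rightarrow> real) \<Rightarrow> real ^ 'm::{finite,linorder} ^ 'm::_" where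
  "matA_star d = (\<chi> i j. if pos j = 1 then - (1 / d (CARD('m) + 1)) * d (CARD('m) + 1 - pos i)
                          else if pos j = pos i + 1 then 1 else 0)"

definition vecB_star :: "(nat \<Rightarrow> real) \<Rightarrow> (nat \<Rightarrow> real) \<Rightarrow> real ^ 'm::{finite,linorder}" where
  "vecB_star d n = (\<chi> i. n (CARD('m) + 1 - pos i)
                         - n (CARD('m) + 1) / d (CARD('m) + 1) * d (CARD('m) + 1 - pos i))"


subsection \<open>Support vectors\<close>

text \<open>On the nonempty compact sets considered here the supremum is a maximum.\<close>

definition support_fun :: "'a::real_inner set \<Rightarrow> 'a \<Rightarrow> real" where
  "support_fun S xs = (SUP x\<in>S. xs \<bullet> x)"

definition support_vectors :: "'a::real_inner set \<Rightarrow> 'a \<Rightarrow> 'a set" where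
  "support_vectors S x = {xs. xs \<noteq> 0 \<and> xs \<bullet> x = support_fun S xs}"

text \<open>
  The sets \<open>R\<^sub>1\<close>, \<open>R\<^sub>2\<close>, \<open>R\<^sub>3\<close> are the support vectors at \<open>x\<close> whose first component is zero,
  positive, negative. If \<open>x\<close> is a boundary point and \<open>R\<^sub>1\<close> is empty, then exactly one of
  \<open>R\<^sub>2\<close>, \<open>R\<^sub>3\<close> is nonempty, so the last branch is the case \<open>R\<^sub>3 \<noteq> {}\<close>.
\<close>

definition R_set :: "(real ^ 'm::{finite,linorder}) set \<Rightarrow> real ^ 'm::_ \<Rightarrow> (real ^ 'm::_) set" where
  "R_set S x =
     (let R1 = {xs \<in> support_vectors S x. first_comp xs = 0};
          R2 = {xs \<in> support_vectors S x. first_comp xs > 0};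
          R3 = {xs \<in> support_vectors S x. first_comp xs < 0}
      in if R1 \<noteq> {} then R1 else if R2 \<noteq> {} then R2 else R3)"


subsection \<open>Alignment and propagation\<close>

text \<open>\<open>aligned zk y v ys vs\<close>: the pair \<open>(y, v)\<close> is aligned with \<open>(ys, vs)\<close> for the measurement \<open>zk\<close>.\<close>

definition aligned :: "real \<Rightarrow> real \<Rightarrow> real \<Rightarrow> real \<Rightarrow> real \<Rightarrow> bool" where
  "aligned zk y v ys vs \<longleftrightarrow>
     (vs > 0 \<longrightarrow> v = 1) \<and> (vs < 0 \<longrightarrow> v = -1) \<and> (\<bar>v\<bar> < 1 \<longrightarrow> vs = 0) \<and>
     (ys > 0 \<longrightarrow> y = 1 + zk) \<and> (ys < 0 \<longrightarrow> y = -1 + zk) \<and> (\<bar>y - zk\<bar> < 1 \<longrightarrow> ys = 0)"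

text \<open>Elements are the quadruples \<open>(v, y, vs, ys)\<close>; \<open>m\<close> is the dimension of the system.\<close>

definition M_set ::
  "nat \<Rightarrow> (nat \<Rightarrow> real) \<Rightarrow> (nat \<Rightarrow> real) \<Rightarrow> real \<Rightarrow> real \<Rightarrow> real
     \<Rightarrow> (real \<times> real \<times> real \<times> real) set" where
  "M_set m d n s t zk =
     {(v, y, vs, ys). \<bar>v\<bar> \<le> 1 \<and> \<bar>y - zk\<bar> \<le> 1 \<and> y - n 1 * v = s \<and>
        d (m + 1) * vs + n (m + 1) * ys = - t \<and> aligned zk y v ys vs}"

definition T_set ::
  "(nat \<Rightarrow> real) \<Rightarrow> (nat \<Rightarrow> real) \<Rightarrow> real ^ 'm::{finite,linorder} \<Rightarrow> real ^ 'm::_ \<Rightarrow> real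
     \<Rightarrow> ((real ^ 'm::_) \<times> (real ^ 'm::_)) set" where
  "T_set d n x xs zk =
     {(matA d *v x + v *\<^sub>R vecB, matA_star d *v xs + ys *\<^sub>R vecB_star d n) | v y vs ys.
        (v, y, vs, ys) \<in> M_set CARD('m) d n (vecC d n \<bullet> x) (first_comp xs) zk \<and>
        matA_star d *v xs + ys *\<^sub>R vecB_star d n \<noteq> 0}"

definition X_of :: "('a \<times> 'b) set \<Rightarrow> 'a set" where
  "X_of T = {x. \<exists>xs. (x, xs) \<in> T}"

end

theory Submission
  imports Defs
begin

text \<open>
  With \<open>w\<close> the new dual vector, the matrices of the regulator system are designed such that
  \<open>\<langle>w, A x + B v\<rangle> = \<langle>x\<^sup>*, x\<rangle> + y\<^sup>* (C x + D\<^sub>1 v) + v\<^sup>* v\<close> for all \<open>x\<close> and \<open>v\<close>. On the constraint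
  set, the first summand is maximal at the old point because \<open>x\<^sup>*\<close> supports \<open>S\<^bsub>k-1\<^esub>\<close> there, and the
  other two are maximal at the chosen \<open>(y, v)\<close> by alignment. Hence \<open>w \<noteq> 0\<close> supports \<open>S\<^sub>k\<close> at the new
  point, which is therefore not interior.
\<close>

section \<open>Coordinate positions in the index type\<close>

lemma pos_strict_mono: "strict_mono (pos :: 'm::{finite,linorder} \<Rightarrow> nat)"
proof (rule strict_monoI)
  fix i j :: 'm
  assume "i < j"
  then have "{l. l \<le> i} \<subset> {l. l \<le> j}"
    by force
  then show "pos i < pos j"
    unfolding pos_def by (intro psubset_card_mono) auto
qed

lemma pos_eq_iff [simp]: "pos i = pos j \<longleftrightarrow> i = j"
  using pos_strict_mono by (metis strict_mono_eq)

lemma pos_ge_1: "1 \<le> pos i"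
  unfolding pos_def by (simp add: Suc_le_eq card_gt_0_iff) blast

lemma pos_le_CARD: "pos (i :: 'm::{finite,linorder}) \<le> CARD('m)"
  unfolding pos_def by (intro card_mono) auto

lemma range_pos: "range (pos :: 'm::{finite,linorder} \<Rightarrow> nat) = {1..CARD('m)}"
proof (rule card_subset_eq)
  show "card (range (pos :: 'm \<Rightarrow> nat)) = card {1..CARD('m)}"
    by (simp add: card_image inj_on_def)
qed (use pos_ge_1 pos_le_CARD in auto)

lemma pos_surj:
  assumes "1 \<le> p" "p \<le> CARD('m)"
  obtains i :: "'m::{finite,linorder}" where "pos i = p"
  using assms range_pos[where 'm = 'm] by (metis atLeastAtMost_iff imageE)

lemma pos_Min: "pos (Min UNIV :: 'm::{finite,linorder}) = 1"
proof -
  have "{j. j \<le> (Min UNIV :: 'm)} = {Min UNIV}"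
    by (auto intro: antisym)
  then show ?thesis
    by (simp add: pos_def)
qed

lemma pos_eq_1_iff: "pos (i :: 'm::{finite,linorder}) = Suc 0 \<longleftrightarrow> i = Min UNIV"
  by (metis One_nat_def pos_Min pos_eq_iff)

section \<open>Adjointness of the estimation and regulator systems\<close>

text \<open>The conditional sum encodes a shift: it has at most one nonzero term, the coordinate
  after \<open>i\<close>, and is 0 when \<open>i\<close> is the last index.\<close>

lemma matA_star_mult_nth:
  fixes xs :: "real ^ 'm::{finite,linorder}"
  shows "(matA_star d *v xs) $ i = - (d (CARD('m) + 1 - pos i) / d (CARD('m) + 1)) * first_comp xs
           + (\<Sum>j\<in>UNIV. if pos j = pos i + 1 then xs $ j else 0)"
proof -
  \<comment> \<open>The first column and the superdiagonal are disjoint because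
    \<open>pos i + 1\<close> is at least 2, so the entry splits into a sum.\<close>
  have "matA_star d $ i $ j * xs $ j =
      (if j = Min UNIV then - (d (CARD('m) + 1 - pos i) / d (CARD('m) + 1)) * xs $ j else 0)
        + (if pos j = pos i + 1 then xs $ j else 0)" for j
    using pos_ge_1[of i] by (auto simp: matA_star_def pos_eq_1_iff pos_Min)
  then show ?thesis
    by (simp add: matrix_vector_mult_def sum.distrib first_comp_def)
qed

lemma vector_matrix_mult_matA_nth:
  fixes w :: "real ^ 'm::{finite,linorder}"
  assumes "pos top_ix = CARD('m)"
  shows "(w v* matA d) $ j = (\<Sum>i\<in>UNIV. if pos j = pos i + 1 then w $ i else 0)
           - d (CARD('m) + 2 - pos j) * w $ top_ix"
proof -
  have top_iff: "pos i = CARD('m) \<longleftrightarrow> i = top_ix" for i :: 'm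
    using assms by (metis pos_eq_iff)
  have "w $ i * matA d $ i $ j = (if pos j = pos i + 1 then w $ i else 0)
          + (if i = top_ix then - d (CARD('m) + 2 - pos j) * w $ i else 0)" for i
  proof -
    \<comment> \<open>The superdiagonal does not meet the last row, so the two contributions can be
      added.\<close>
    have "pos j \<noteq> Suc (pos top_ix)"
      using pos_le_CARD[of j] assms by linarith
    then show ?thesis
      by (auto simp: matA_def top_iff)
  qed
  then show ?thesis
    by (simp add: vector_matrix_mult_def sum.distrib)
qed

lemma inner_matrix_vector_mult:
  fixes A :: "real ^ 'n ^ 'm"
  shows "w \<bullet> (A *v x) = (w v* A) \<bullet> x"
  by (metis dot_lmul_matrix)

text \<open>Comparing coefficients of \<open>x\<close> and \<open>v\<close> leaves two identities:
  \<open>w v* matA d = xs + ys *\<^sub>R vecC d n\<close>, and the last coordinate of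
  \<open>w\<close> is \<open>vs + n 1 * ys\<close>.\<close>

lemma regulator_adjoint:
  fixes xs x :: "real ^ 'm::{finite,linorder}"
  assumes d1: "d 1 = 1" and dm: "d (CARD('m) + 1) \<noteq> 0"
    and dual: "d (CARD('m) + 1) * vs + n (CARD('m) + 1) * ys = - first_comp xs"
  defines "w \<equiv> matA_star d *v xs + ys *\<^sub>R vecB_star d n"
  shows "w \<bullet> (matA d *v x + v *\<^sub>R vecB) = xs \<bullet> x + ys * (vecC d n \<bullet> x + n 1 * v) + vs * v"
proof -
  obtain top_ix :: 'm where top: "pos top_ix = CARD('m)"
    using pos_surj[of "CARD('m)", where 'm = 'm] by (auto simp: Suc_le_eq)
  have top_iff: "pos i = CARD('m) \<longleftrightarrow> i = top_ix" for i :: 'm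
    using top by (metis pos_eq_iff)
  have first: "first_comp xs = - (d (CARD('m) + 1) * vs + n (CARD('m) + 1) * ys)"
    using dual by simp
  \<comment> \<open>Substituting \<open>dual\<close> for the first component cancels the division by
    \<open>d (CARD('m) + 1)\<close> and, with it, the correction term in
    \<open>vecB_star\<close>.\<close>
  have w_nth: "w $ i = (\<Sum>j\<in>UNIV. if pos j = pos i + 1 then xs $ j else 0)
      + d (CARD('m) + 1 - pos i) * vs + n (CARD('m) + 1 - pos i) * ys" for i
    unfolding w_def using dm
    by (simp add: matA_star_mult_nth vecB_star_def first field_simps)
  have no_next: "(\<Sum>j\<in>UNIV. if pos (j :: 'm) = pos top_ix + 1 then xs $ j else 0) = 0"
  proof (intro sum.neutral ballI)
    fix j :: 'm
    show "(if pos j = pos top_ix + 1 then xs $ j else 0) = 0"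
      using pos_le_CARD[of j] top by simp
  qed
  have w_top: "w $ top_ix = vs + n 1 * ys"
    using w_nth[of top_ix] no_next d1 by (simp add: top)
  have "(w v* matA d) $ j = xs $ j + ys * vecC d n $ j" for j
  \<comment> \<open>The first column of \<open>matA d\<close> has only its last-row entry, with
    coefficient index \<open>CARD('m) + 1\<close>; here \<open>dual\<close> supplies the component
    of \<open>xs\<close>. In the other columns the shift brings in \<open>w $ i\<close> for the
    preceding \<open>i\<close>, and the \<open>vs\<close> terms cancel.\<close>
  proof (cases "pos j = 1")
    case True
    then have "(\<Sum>i\<in>UNIV. if pos j = pos (i :: 'm) + 1 then w $ i else 0) = 0"
    proof (intro sum.neutral ballI)
      fix i :: 'm
      show "(if pos j = pos i + 1 then w $ i else 0) = 0"
        using True pos_ge_1[of i] by simp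
    qed
    moreover have "xs $ j = first_comp xs"
      using True by (simp add: first_comp_def pos_eq_1_iff)
    ultimately show ?thesis
      using True by (simp add: vector_matrix_mult_matA_nth[OF top] w_top vecC_def first algebra_simps)
  next
    case False
    then have "1 \<le> pos j - 1" "pos j - 1 \<le> CARD('m)"
      using pos_ge_1[of j] pos_le_CARD[of j] by linarith+
    then obtain i :: 'm where i: "pos i = pos j - 1"
      by (rule pos_surj)
    then have j: "pos j = pos i + 1"
      using \<open>1 \<le> pos j - 1\<close> by simp
    have "(\<Sum>l\<in>UNIV. if pos j = pos l + 1 then w $ l else 0) = w $ i"
      unfolding j by simp
    moreover have "(\<Sum>l\<in>UNIV. if pos l = pos i + 1 then xs $ l else 0) = xs $ j"
      unfolding j [symmetric] by simp
    then have "w $ i = xs $ j + d (CARD('m) + 2 - pos j) * vs + n (CARD('m) + 2 - pos j) * ys"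
      unfolding w_nth j by simp
    ultimately show ?thesis
      by (simp add: vector_matrix_mult_matA_nth[OF top] w_top vecC_def algebra_simps)
  qed
  then have "w v* matA d = xs + ys *\<^sub>R vecC d n"
    by (simp add: vec_eq_iff)
  moreover have "w \<bullet> vecB = w $ top_ix"
    by (simp add: inner_vec_def vecB_def top_iff if_distrib cong: if_cong)
  ultimately show ?thesis
    by (simp add: inner_add_right inner_add_left inner_matrix_vector_mult w_top algebra_simps)
qed

section \<open>Compactness, support and alignment\<close>

lemma compact_uncertainty_set: "compact (uncertainty_set d n x0 z k)"
proof (induction k)
  case 0
  show ?case by simp
next
  case (Suc k)
  let ?S = "uncertainty_set d n x0 z k"
  \<comment> \<open>The admissible pairs of state and input; the next uncertainty set is their image
    under a continuous map.\<close>
  let ?K = "(?S \<times> {-1..1}) \<inter> {p. \<bar>vecC d n \<bullet> fst p + n 1 * snd p - z (Suc k)\<bar> \<le> 1}"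
  have "closed {p. \<bar>vecC d n \<bullet> fst p + n 1 * snd p - z (Suc k)\<bar> \<le> 1}"
    by (intro closed_Collect_le continuous_intros)
  then have "compact ?K"
    by (intro compact_Int_closed compact_Times Suc compact_Icc)
  moreover have "continuous_on ?K (\<lambda>p. matA d *v fst p + snd p *\<^sub>R vecB)"
    by (intro continuous_intros matrix_vector_mult_linear_continuous_on continuous_on_compose2
          [OF matrix_vector_mult_linear_continuous_on[of UNIV]]) auto
  moreover have "uncertainty_set d n x0 z (Suc k) = (\<lambda>p. matA d *v fst p + snd p *\<^sub>R vecB) ` ?K"
    (is "?L = ?R")
  proof
    show "?L \<subseteq> ?R"
    proof
      fix x'
      assume "x' \<in> ?L"
      then obtain x v where "x \<in> ?S" "\<bar>v\<bar> \<le> 1" "\<bar>vecC d n \<bullet> x + n 1 * v - z (Suc k)\<bar> \<le> 1"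
        and "x' = matA d *v x + v *\<^sub>R vecB"
        by auto
      then show "x' \<in> ?R"
        by (intro image_eqI[where x = "(x, v)"]) auto
    qed
    show "?R \<subseteq> ?L"
    proof
      fix x'
      assume "x' \<in> ?R"
      then obtain p where "p \<in> ?K" "x' = matA d *v fst p + snd p *\<^sub>R vecB"
        by blast
      then show "x' \<in> ?L"
        unfolding uncertainty_set.simps
        by (intro CollectI exI[of _ "fst p"] exI[of _ "snd p"]) auto
    qed
  qed
  ultimately show ?case
    by (simp only: compact_continuous_image)
qed

text \<open>Compactness bounds the inner products above, so the supremum is a genuine upper bound,
  attained at \<open>x\<close> exactly when \<open>x\<close> maximizes.\<close>

lemma support_vectors_iff:
  assumes "compact S" "x \<in> S"
  shows "xs \<in> support_vectors S x \<longleftrightarrow> xs \<noteq> 0 \<and> (\<forall>y\<in>S. xs \<bullet> y \<le> xs \<bullet> x)"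
proof -
  have "compact ((\<bullet>) xs ` S)"
    using assms by (intro compact_continuous_image continuous_intros)
  then have bdd: "bdd_above ((\<bullet>) xs ` S)"
    by (simp add: bounded_imp_bdd_above compact_imp_bounded)
  have "xs \<bullet> x = support_fun S xs \<longleftrightarrow> (\<forall>y\<in>S. xs \<bullet> y \<le> xs \<bullet> x)"
  proof
    assume "xs \<bullet> x = support_fun S xs"
    then show "\<forall>y\<in>S. xs \<bullet> y \<le> xs \<bullet> x"
      using bdd by (simp add: support_fun_def cSUP_upper)
  next
    assume "\<forall>y\<in>S. xs \<bullet> y \<le> xs \<bullet> x"
    then show "xs \<bullet> x = support_fun S xs"
      unfolding support_fun_def using assms(2) by (intro cSup_eq_maximum [symmetric]) auto
  qed
  then show ?thesis
    by (simp add: support_vectors_def)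
qed

lemma supported_imp_frontier:
  fixes w :: "'a::real_inner"
  assumes "x \<in> S" "w \<noteq> 0" and le: "\<And>y. y \<in> S \<Longrightarrow> w \<bullet> y \<le> w \<bullet> x"
  shows "x \<in> frontier S"
proof -
  have "x \<notin> interior S"
  proof
    assume "x \<in> interior S"
    then obtain e where e: "e > 0" "ball x e \<subseteq> S"
      by (meson mem_interior)
    \<comment> \<open>A step of length \<open>e / 2\<close> along \<open>w\<close> stays in the ball
      and strictly increases the inner product with \<open>w\<close>.\<close>
    define y where "y = x + (e / (2 * norm w)) *\<^sub>R w"
    have "y \<in> S"
      using e \<open>w \<noteq> 0\<close> by (intro subsetD[OF e(2)]) (simp add: y_def dist_norm)
    moreover have "w \<bullet> x < w \<bullet> y"
      using e \<open>w \<noteq> 0\<close> by (simp add: y_def inner_add_right)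
    ultimately show False
      using le[of y] by simp
  qed
  then show ?thesis
    using \<open>x \<in> S\<close> closure_subset by (auto simp: frontier_def)
qed

text \<open>A nonzero multiplier forces its variable to the end of the interval that maximizes the
  product; for a zero multiplier both sides vanish.\<close>

lemma aligned_maximal:
  assumes "aligned zk y v ys vs" "\<bar>v'\<bar> \<le> 1" "\<bar>y' - zk\<bar> \<le> 1"
  shows "ys * y' \<le> ys * y" and "vs * v' \<le> vs * v"
proof -
  show "ys * y' \<le> ys * y"
    using assms by (cases ys "0::real" rule: linorder_cases)
      (auto simp: aligned_def abs_le_iff mult_le_cancel_left)
  show "vs * v' \<le> vs * v"
    using assms mult_left_mono_neg[of "-1" v' vs]
    by (cases vs "0::real" rule: linorder_cases)
      (auto simp: aligned_def abs_le_iff mult_le_cancel_left)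
qed

lemma R_set_subset_support_vectors: "R_set S x \<subseteq> support_vectors S x"
  by (auto simp: R_set_def Let_def split: if_splits)

theorem theorem3p6:
  fixes d n z :: "nat \<Rightarrow> real"
    and x0 x_prev x_prev_star x_next :: "real ^ 'm::{finite,linorder}"
    and k :: nat
  assumes "d 1 = 1" and "d (CARD('m) + 1) \<noteq> 0"
    and "coprime (coeff_poly CARD('m) n) (coeff_poly CARD('m) d)"
    and "k \<ge> 1"
    and "interior (uncertainty_set d n x0 z (k - 1)) \<noteq> {}"
    and "x_prev \<in> frontier (uncertainty_set d n x0 z (k - 1))"
    and "x_prev_star \<in> R_set (uncertainty_set d n x0 z (k - 1)) x_prev"
    and "x_next \<in> X_of (T_set d n x_prev x_prev_star (z k))"
  shows "successor d n x0 z k x_next x_prev \<and> x_next \<in> frontier (uncertainty_set d n x0 z k)"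
proof -
  let ?S = "uncertainty_set d n x0 z (k - 1)" and ?S' = "uncertainty_set d n x0 z k"
  have S': "?S' = {matA d *v x + v *\<^sub>R vecB | x v.
      x \<in> ?S \<and> \<bar>v\<bar> \<le> 1 \<and> \<bar>vecC d n \<bullet> x + n 1 * v - z k\<bar> \<le> 1}"
    using \<open>k \<ge> 1\<close> by (cases k) auto
  have "compact ?S"
    by (rule compact_uncertainty_set)
  then have prev: "x_prev \<in> ?S"
    using assms(6) by (metis compact_imp_closed frontier_subset_closed subsetD)
  then have supp: "x_prev_star \<bullet> x \<le> x_prev_star \<bullet> x_prev" if "x \<in> ?S" for x
    using assms(7) that R_set_subset_support_vectors support_vectors_iff[OF \<open>compact ?S\<close> prev] by blast
  obtain v y vs ys where
    M: "(v, y, vs, ys) \<in> M_set CARD('m) d n (vecC d n \<bullet> x_prev) (first_comp x_prev_star) (z k)"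
    and w0: "matA_star d *v x_prev_star + ys *\<^sub>R vecB_star d n \<noteq> 0"
    and next_eq: "x_next = matA d *v x_prev + v *\<^sub>R vecB"
    using assms(8) unfolding X_of_def T_set_def by blast
  from M have v: "\<bar>v\<bar> \<le> 1" and y: "\<bar>y - z k\<bar> \<le> 1" "y = vecC d n \<bullet> x_prev + n 1 * v"
    and dual: "d (CARD('m) + 1) * vs + n (CARD('m) + 1) * ys = - first_comp x_prev_star"
    and al: "aligned (z k) y v ys vs"
    by (auto simp: M_set_def)
  \<comment> \<open>State and input remain free here, so the same identity applies to the chosen
    pair and to every competing one.\<close>
  note adj = regulator_adjoint[where n = n, OF assms(1,2) dual]
  have next_in: "x_next \<in> ?S'"
    unfolding S' using prev v y next_eq by blast
  have "x_next \<in> frontier ?S'"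
  proof (rule supported_imp_frontier[OF next_in w0])
    fix x'
    assume "x' \<in> ?S'"
    then obtain x u where x: "x \<in> ?S" "\<bar>u\<bar> \<le> 1" "\<bar>vecC d n \<bullet> x + n 1 * u - z k\<bar> \<le> 1"
      and x': "x' = matA d *v x + u *\<^sub>R vecB"
      unfolding S' by blast
    show "(matA_star d *v x_prev_star + ys *\<^sub>R vecB_star d n) \<bullet> x'
        \<le> (matA_star d *v x_prev_star + ys *\<^sub>R vecB_star d n) \<bullet> x_next"
      \<comment> \<open>Both sides become sums of three terms, compared one by one: support at
        \<open>x_prev\<close> for the first, alignment for the other two.\<close>
      unfolding x' next_eq adj
      using aligned_maximal[OF al x(2,3)] supp[OF x(1)] y(2) by (intro add_mono) auto
  qed
  moreover have "successor d n x0 z k x_next x_prev"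
    unfolding successor_def using prev next_in v y next_eq by blast
  ultimately show ?thesis
    by blast
qed

end
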